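(* Suppose $\epsilon_{\max},\alpha\in(0,1)$ are constants satisfying $n\ge 1/\epsilon_{\max}$ and $\underline{q}(\epsilon_{\max})\le 1$. Then, for each choice of sign $\pm$, $$\inf_{Q_0,Q_1}\mathsf{TV}\Big(P^{\otimes n}_{\epsilon_{\max},\theta,Q_0},\ P^{\otimes n}_{\epsilon,\theta\pm\underline{r}(\epsilon),Q_1}\Big)\le\alpha$$ for all $\theta\in\mathbb{R}$ and $\epsilon\in[0,\epsilon_{\max}]$, where the infimum is over all probability distributions $Q_0,Q_1$ on $\mathbb{R}$.
   Context: Location model: $X\sim P_\theta$ iff $X-\theta\sim P_0$, where $P_0$ is a distribution on $\mathbb{R}$ with a density $f$ that is continuous on its support and symmetric around $0$; $F$ is the CDF of $P_0$ and $F^{-1}(q)=\inf\{t\in\mathbb{R}:F(t)\ge q\}$. For a distribution $Q$, $P_{\epsilon,\theta,Q}=(1-\epsilon)P_\theta+\epsilon Q$, and $P^{\otimes n}$ is the $n$-fold product distribution. $\mathsf{TV}(P,Q)=\sup_B|P(B)-Q(B)|$. With $a\vee b=\max(a,b)$, for $\epsilon\in[0,\epsilon_{\max}]$ define $$\underline{q}(\epsilon)=\frac{1}{2(1-\epsilon_{\max})}\left(\epsilon+\frac{\alpha(1-\epsilon_{\max})}{n}\right),$$ $$\underline{r}(\epsilon)=\sup\left\{r\ge 0:\ \sup_{t\le r+F^{-1}(1-\underline{q}(\epsilon))}\Big(f(t-r)-\frac{1-(\epsilon\vee\frac{\alpha}{n})}{1-\epsilon_{\max}}f(t)\Big)\le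 0\right\}.$$ *)

theory Defs
  imports "HOL-Probability.Probability"
begin

definition location_shift :: "real measure \<Rightarrow> real \<Rightarrow> real measure" where
  "location_shift P0 \<theta> = distr P0 borel (\<lambda>x. x + \<theta>)"

definition mixture :: "real \<Rightarrow> real measure \<Rightarrow> real measure \<Rightarrow> real measure" where
  "mixture \<epsilon> P Q = measure_of UNIV (sets borel)
     (\<lambda>A. ennreal (1 - \<epsilon>) * emeasure P A + ennreal \<epsilon> * emeasure Q A)"

lemma space_mixture [simp]: "space (mixture \<epsilon> P Q) = UNIV"
  by (simp add: mixture_def space_measure_of_conv)

lemma sets_mixture [simp, measurable_cong]: "sets (mixture \<epsilon> P Q) = sets borel"
  using sets.sigma_sets_eq[of "borel :: real measure"] by (simp add: mixture_def)

lemma emeasure_mixture: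
  assumes "sets P = sets borel" "sets Q = sets borel" "A \<in> sets borel"
  shows "emeasure (mixture \<epsilon> P Q) A =
    ennreal (1 - \<epsilon>) * emeasure P A + ennreal \<epsilon> * emeasure Q A"
proof (rule emeasure_measure_of[OF mixture_def])
  show "A \<in> sets (mixture \<epsilon> P Q)" using assms by simp
  show "sets borel \<subseteq> Pow (UNIV :: real set)" by simp
  show "positive (sets (mixture \<epsilon> P Q))
    (\<lambda>A. ennreal (1 - \<epsilon>) * emeasure P A + ennreal \<epsilon> * emeasure Q A)"
    by (simp add: positive_def)
  show "countably_additive (sets (mixture \<epsilon> P Q))
    (\<lambda>A. ennreal (1 - \<epsilon>) * emeasure P A + ennreal \<epsilon> * emeasure Q A)"
  proof (rule countably_additiveI)
    fix B :: "nat \<Rightarrow> real set"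
    assume B: "range B \<subseteq> sets (mixture \<epsilon> P Q)" and d: "disjoint_family B"
    have "(\<Sum>i. ennreal (1 - \<epsilon>) * emeasure P (B i) + ennreal \<epsilon> * emeasure Q (B i)) =
        (\<Sum>i. ennreal (1 - \<epsilon>) * emeasure P (B i)) + (\<Sum>i. ennreal \<epsilon> * emeasure Q (B i))"
      by (rule suminf_add[symmetric]) auto
    then show "(\<Sum>i. ennreal (1 - \<epsilon>) * emeasure P (B i) + ennreal \<epsilon> * emeasure Q (B i)) =
        ennreal (1 - \<epsilon>) * emeasure P (\<Union>i. B i) + ennreal \<epsilon> * emeasure Q (\<Union>i. B i)"
      using B d assms(1,2) by (simp add: suminf_emeasure)
  qed
qed

definition contaminated ::
    "real measure \<Rightarrow> real \<Rightarrow> real \<Rightarrow> real measure \<Rightarrow> real measure" where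
  "contaminated P0 \<epsilon> \<theta> Q = mixture \<epsilon> (location_shift P0 \<theta>) Q"

definition iid_product :: "nat \<Rightarrow> real measure \<Rightarrow> (nat \<Rightarrow> real) measure" where
  "iid_product n P = PiM {..<n} (\<lambda>_. P)"

definition TV :: "'a measure \<Rightarrow> 'a measure \<Rightarrow> real" where
  "TV P Q = (SUP B\<in>sets P. \<bar>measure P B - measure Q B\<bar>)"

text \<open>
  The quantile is taken in the extended reals because its value at level \<open>0\<close> is \<open>-\<infinity>\<close>.
\<close>

definition quantile :: "real measure \<Rightarrow> real \<Rightarrow> ereal" where
  "quantile P q = (INF t\<in>{t. cdf P t \<ge> q}. ereal t)"

definition q_low :: "real \<Rightarrow> real \<Rightarrow> nat \<Rightarrow> real \<Rightarrow> real" where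
  "q_low \<epsilon>max \<alpha> n \<epsilon> = 1 / (2 * (1 - \<epsilon>max)) * (\<epsilon> + \<alpha> * (1 - \<epsilon>max) / real n)"

text \<open>
  Both suprema are taken in the extended reals. If the quantile level is \<open>0\<close>, the inner
  supremum ranges over the empty set and is \<open>-\<infinity>\<close>, so the outer one is \<open>\<infinity>\<close>.
\<close>

definition r_low ::
    "real measure \<Rightarrow> (real \<Rightarrow> real) \<Rightarrow> real \<Rightarrow> real \<Rightarrow> nat \<Rightarrow> real \<Rightarrow> ereal" where
  "r_low P0 f \<epsilon>max \<alpha> n \<epsilon> =
    (SUP r\<in>{r::real. r \<ge> 0 \<and>
        (SUP t\<in>{t::real. ereal t \<le> ereal r + quantile P0 (1 - q_low \<epsilon>max \<alpha> n \<epsilon>)}.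
           ereal (f (t - r) - (1 - max \<epsilon> (\<alpha> / real n)) / (1 - \<epsilon>max) * f t)) \<le> 0}.
      ereal r)"

end

theory Submission
  imports Defs
begin

text \<open>
  It suffices to bring the one-sample distributions within \<open>\<alpha> / n\<close> of each other. Let \<open>T\<close> be
  the tail of \<open>P\<^sub>\<theta>\<close> of mass \<open>q\<close> beyond the quantile. The definition of \<open>r\<close> says that off \<open>T\<close>
  the measure \<open>(1 - \<epsilon>max) P\<^sub>\<theta>\<close> is dominated by \<open>(1 - \<epsilon>)\<close> times the shifted one, so with \<open>Q1\<close>
  the conditional law of \<open>P\<^sub>\<theta>\<close> on \<open>T\<close> the mixture \<open>G = (1 - \<epsilon>) P' + \<epsilon> Q1\<close> falls short of
  \<open>(1 - \<epsilon>max) P\<^sub>\<theta>\<close> by at most \<open>max 0 ((1 - \<epsilon>max) q - \<epsilon>) \<le> \<alpha> / n\<close> on every set. Taking \<open>Q0\<close>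
  proportional to the positive part of \<open>G - (1 - \<epsilon>max) P\<^sub>\<theta>\<close> then leaves only this shortfall as
  total variation distance.

  The supremum \<open>r\<close> need not satisfy the pointwise density inequality, because \<open>f\<close> may be discontinuous
  as a function on the line. The domination of measures does pass to the limit: on compact sets by
  outer regularity, and then on Borel sets by inner regularity.
\<close>

section \<open>Total variation bounds for product measures\<close>

text \<open>The intermediate product of \<open>M1\<close> and \<open>N2\<close> differs from either
  side in one factor only, and each difference is an integral, over the shared factor, of
  differences of section measures.\<close>

lemma abs_measure_pair_diff_le:
  assumes M1: "prob_space M1" and M2: "prob_space M2" and N1: "prob_space N1" and N2: "prob_space N2"
    and sM [measurable_cong]: "sets M2 = sets M1" and sN [measurable_cong]: "sets N2 = sets N1"
    and dM: "\<And>A. A \<in> sets M1 \<Longrightarrow> \<bar>measure M1 A - measure M2 A\<bar> \<le> a"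
    and dN: "\<And>A. A \<in> sets N1 \<Longrightarrow> \<bar>measure N1 A - measure N2 A\<bar> \<le> b"
    and B [measurable]: "B \<in> sets (M1 \<Otimes>\<^sub>M N1)"
  shows "\<bar>measure (M1 \<Otimes>\<^sub>M N1) B - measure (M2 \<Otimes>\<^sub>M N2) B\<bar> \<le> a + b"
proof -
  interpret M1: prob_space M1 by fact
  interpret M2: prob_space M2 by fact
  interpret N1: prob_space N1 by fact
  interpret N2: prob_space N2 by fact
  interpret P11: pair_prob_space M1 N1 ..
  interpret P12: pair_prob_space M1 N2 ..
  interpret P22: pair_prob_space M2 N2 ..
  have sets12: "sets (M1 \<Otimes>\<^sub>M N2) = sets (M1 \<Otimes>\<^sub>M N1)"
    and sets22: "sets (M2 \<Otimes>\<^sub>M N2) = sets (M1 \<Otimes>\<^sub>M N1)"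
    by (auto intro!: sets_pair_measure_cong simp: sM sN)
  have B12: "B \<in> sets (M1 \<Otimes>\<^sub>M N2)" and B22: "B \<in> sets (M2 \<Otimes>\<^sub>M N2)"
    using B sets12 sets22 by simp_all
  let ?n1 = "\<lambda>x. measure N1 (Pair x -` B)" and ?n2 = "\<lambda>x. measure N2 (Pair x -` B)"
  let ?m1 = "\<lambda>y. measure M1 ((\<lambda>x. (x, y)) -` B)" and ?m2 = "\<lambda>y. measure M2 ((\<lambda>x. (x, y)) -` B)"
  have n1_meas [measurable]: "?n1 \<in> borel_measurable M1"
    using N1.measurable_emeasure_Pair[OF B] unfolding measure_def by measurable
  have n2_meas [measurable]: "?n2 \<in> borel_measurable M1"
    using N2.measurable_emeasure_Pair[OF B12] unfolding measure_def by measurable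
  have m1_meas [measurable]: "?m1 \<in> borel_measurable N2"
    using P12.measurable_emeasure_Pair2[OF B12] unfolding measure_def by measurable
  have m2_meas [measurable]: "?m2 \<in> borel_measurable N2"
    using P22.measurable_emeasure_Pair2[OF B22] unfolding measure_def by measurable
  have e11: "measure (M1 \<Otimes>\<^sub>M N1) B = (\<integral>x. ?n1 x \<partial>M1)"
    unfolding measure_def N1.emeasure_pair_measure_alt[OF B]
    by (subst integral_eq_nn_integral) (auto simp: N1.emeasure_eq_measure)
  have e12: "measure (M1 \<Otimes>\<^sub>M N2) B = (\<integral>x. ?n2 x \<partial>M1)"
    unfolding measure_def N2.emeasure_pair_measure_alt[OF B12]
    by (subst integral_eq_nn_integral) (auto simp: N2.emeasure_eq_measure)
  \<comment> \<open>The intermediate product is computed by sections in both directions: over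
    \<open>x\<close> for the comparison with \<open>N1\<close>, over \<open>y\<close> for the
    comparison with \<open>M2\<close>.\<close>
  have e12': "measure (M1 \<Otimes>\<^sub>M N2) B = (\<integral>y. ?m1 y \<partial>N2)"
    unfolding measure_def P12.emeasure_pair_measure_alt2[OF B12]
    by (subst integral_eq_nn_integral) (auto simp: M1.emeasure_eq_measure)
  have e22: "measure (M2 \<Otimes>\<^sub>M N2) B = (\<integral>y. ?m2 y \<partial>N2)"
    unfolding measure_def P22.emeasure_pair_measure_alt2[OF B22]
    by (subst integral_eq_nn_integral) (auto simp: M2.emeasure_eq_measure)
  have int: "integrable M1 ?n1" "integrable M1 ?n2" "integrable N2 ?m1" "integrable N2 ?m2"
    by (auto intro!: M1.integrable_const_bound[of _ 1] N2.integrable_const_bound[of _ 1])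
  have "\<bar>measure (M1 \<Otimes>\<^sub>M N1) B - measure (M1 \<Otimes>\<^sub>M N2) B\<bar> \<le> b"
  proof -
    have "\<bar>\<integral>x. ?n1 x - ?n2 x \<partial>M1\<bar> \<le> (\<integral>x. b \<partial>M1)"
      using int dN by (intro order.trans[OF integral_abs_bound] integral_mono) (auto intro!: sets_Pair1[OF B])
    then show ?thesis using int by (simp add: e11 e12 M1.prob_space)
  qed
  moreover have "\<bar>measure (M1 \<Otimes>\<^sub>M N2) B - measure (M2 \<Otimes>\<^sub>M N2) B\<bar> \<le> a"
  proof -
    have "\<bar>\<integral>y. ?m1 y - ?m2 y \<partial>N2\<bar> \<le> (\<integral>y. a \<partial>N2)"
      using int dM by (intro order.trans[OF integral_abs_bound] integral_mono) (auto intro!: sets_Pair2[OF B])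
    then show ?thesis using int by (simp add: e12' e22 N2.prob_space)
  qed
  ultimately show ?thesis by linarith
qed

text \<open>Splitting off coordinate \<open>n\<close> turns the product into a pair, so each
  coordinate replaced costs one more \<open>\<delta>\<close>.\<close>

lemma abs_measure_iid_product_diff_le:
  assumes G: "prob_space G" and K: "prob_space K" and s: "sets K = sets G"
    and d: "\<And>A. A \<in> sets G \<Longrightarrow> \<bar>measure G A - measure K A\<bar> \<le> \<delta>"
    and "B \<in> sets (iid_product n G)"
  shows "\<bar>measure (iid_product n G) B - measure (iid_product n K) B\<bar> \<le> real n * \<delta>"
  using assms(5)
proof (induction n arbitrary: B)
  case 0
  then show ?case by (simp add: iid_product_def PiM_empty)
next
  case (Suc n)
  let ?upd = "\<lambda>(x, X). X(n := x) :: nat \<Rightarrow> real"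
  have split: "iid_product (Suc n) P =
      distr (P \<Otimes>\<^sub>M iid_product n P) (iid_product (Suc n) P) ?upd" if "prob_space P" for P
    using distr_pair_PiM_eq_PiM[of "{..<n}" "\<lambda>_. P" n] that
    by (simp add: iid_product_def lessThan_Suc)
  have meas: "?upd \<in> P \<Otimes>\<^sub>M iid_product n P \<rightarrow>\<^sub>M iid_product (Suc n) P" for P
    unfolding iid_product_def lessThan_Suc by measurable
  have sets_n: "sets (iid_product m K) = sets (iid_product m G)" for m
    unfolding iid_product_def using s by (intro sets_PiM_cong) auto
  have sp: "space (K \<Otimes>\<^sub>M iid_product n K) = space (G \<Otimes>\<^sub>M iid_product n G)"
    by (simp add: space_pair_measure sets_eq_imp_space_eq[OF s] sets_eq_imp_space_eq[OF sets_n])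
  \<comment> \<open>The products for \<open>G\<close> and \<open>K\<close> have the same underlying
    space, so one preimage serves for both.\<close>
  let ?C = "?upd -` B \<inter> space (G \<Otimes>\<^sub>M iid_product n G)"
  have "measure (iid_product (Suc n) G) B = measure (G \<Otimes>\<^sub>M iid_product n G) ?C"
    by (subst split[OF G]) (rule measure_distr[OF meas Suc.prems])
  moreover have "measure (iid_product (Suc n) K) B = measure (K \<Otimes>\<^sub>M iid_product n K) ?C"
    using measure_distr[OF meas, of B K] Suc.prems sets_n split[OF K] by (simp add: sp)
  moreover have "\<bar>measure (G \<Otimes>\<^sub>M iid_product n G) ?C - measure (K \<Otimes>\<^sub>M iid_product n K) ?C\<bar>
      \<le> \<delta> + real n * \<delta>"
  proof (rule abs_measure_pair_diff_le[OF G K _ _ s sets_n d Suc.IH])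
    show "prob_space (iid_product n G)" "prob_space (iid_product n K)"
      using G K by (auto simp: iid_product_def intro!: prob_space_PiM)
    show "?C \<in> sets (G \<Otimes>\<^sub>M iid_product n G)"
      using measurable_sets[OF meas Suc.prems] .
  qed
  ultimately show ?case by (simp add: algebra_simps)
qed

section \<open>Mixtures and the choice of contaminations\<close>

lemma prob_space_mixture:
  assumes "prob_space P" "prob_space Q" "sets P = sets borel" "sets Q = sets borel" "0 \<le> e" "e \<le> 1"
  shows "prob_space (mixture e P Q)"
proof
  have "emeasure P UNIV = 1" "emeasure Q UNIV = 1"
    using prob_space.emeasure_space_1[OF assms(1)] prob_space.emeasure_space_1[OF assms(2)]
      sets_eq_imp_space_eq[OF assms(3)] sets_eq_imp_space_eq[OF assms(4)] by simp_all
  then show "emeasure (mixture e P Q) (space (mixture e P Q)) = 1"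
    using assms by (simp add: emeasure_mixture ennreal_plus[symmetric] del: ennreal_plus)
qed

lemma measure_mixture:
  assumes "prob_space P" "prob_space Q" "sets P = sets borel" "sets Q = sets borel" "0 \<le> e" "e \<le> 1"
    and "A \<in> sets borel"
  shows "measure (mixture e P Q) A = (1 - e) * measure P A + e * measure Q A"
proof -
  interpret P: prob_space P by fact
  interpret Q: prob_space Q by fact
  show ?thesis
    unfolding measure_def[of "mixture e P Q"] emeasure_mixture[OF assms(3,4,7)]
    using assms(5,6)
    by (simp add: P.emeasure_eq_measure Q.emeasure_eq_measure ennreal_mult[symmetric]
        ennreal_plus[symmetric] del: ennreal_plus)
qed

text \<open>The signed measure \<open>G - (1 - m) P\<close> has total mass \<open>m\<close>, so its
  positive part has mass \<open>N \<ge> m\<close>, and normalising it and weighting it by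
  \<open>m\<close> only shrinks it. The mixture then exceeds \<open>G\<close> by no more than the
  negative part, which \<open>d\<close> bounds.\<close>

lemma ex_contamination_close:
  fixes P G :: "real measure"
  assumes P: "prob_space P" "sets P = sets borel" and G: "prob_space G" "sets G = sets borel"
    and m: "0 < m" "m \<le> 1"
    and d: "\<And>A. A \<in> sets borel \<Longrightarrow> (1 - m) * measure P A - measure G A \<le> \<delta>"
  shows "\<exists>Q. prob_space Q \<and> sets Q = sets borel \<and>
    (\<forall>A\<in>sets borel. \<bar>measure (mixture m P Q) A - measure G A\<bar> \<le> \<delta>)"
proof -
  interpret P: prob_space P by fact
  interpret G: prob_space G by fact
  have [simp]: "space P = UNIV" "space G = UNIV"
    using sets_eq_imp_space_eq[OF P(2)] sets_eq_imp_space_eq[OF G(2)] by simp_all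
  note [measurable_cong] = P(2) G(2)
  note [simp] = P(2) G(2)
  define S where "S = scale_measure (ennreal (1 - m)) P"
  have sS [simp, measurable_cong]: "sets S = sets borel" by (simp add: S_def)
  have eS: "emeasure S A = ennreal ((1 - m) * measure P A)" for A
    using m by (simp add: S_def P.emeasure_eq_measure ennreal_mult)
  have "finite_measure S"
    by (rule finite_measureI) (simp add: eS)
  then obtain Y where Y [measurable]: "Y \<in> sets borel"
    and Y1: "\<And>X. X \<in> sets borel \<Longrightarrow> X \<subseteq> Y \<Longrightarrow> emeasure S X \<le> emeasure G X"
    and Y2: "\<And>X. X \<in> sets borel \<Longrightarrow> X \<inter> Y = {} \<Longrightarrow> emeasure G X \<le> emeasure S X"
    using finite_unsigned_Hahn_decomposition[OF G.finite_measure_axioms, of S] by auto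
  have le1: "(1 - m) * measure P X \<le> measure G X" if "X \<in> sets borel" "X \<subseteq> Y" for X
    using Y1[OF that] by (simp add: eS G.emeasure_eq_measure)
  have le2: "measure G X \<le> (1 - m) * measure P X" if "X \<in> sets borel" "X \<inter> Y = {}" for X
    using Y2[OF that] m by (simp add: eS G.emeasure_eq_measure)
  \<comment> \<open>Restricted to the Hahn set \<open>Y\<close> the difference \<open>G - S\<close>
    is nonnegative on every set, as \<open>diff_measure\<close> requires; the indicator densities
    restrict without changing the sigma-algebra.\<close>
  define D where "D = diff_measure (density G (indicator Y)) (density S (indicator Y))"
  have eD: "emeasure D A = ennreal (measure G (A \<inter> Y) - (1 - m) * measure P (A \<inter> Y))"
    if A [measurable]: "A \<in> sets borel" for A
  proof -
    have dG: "emeasure (density G (indicator Y)) A = emeasure G (A \<inter> Y)" if "A \<in> sets borel" for A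
      using that by (simp add: emeasure_density indicator_inter_arith[symmetric] Int_commute)
    have dS: "emeasure (density S (indicator Y)) A = emeasure S (A \<inter> Y)" if "A \<in> sets borel" for A
      using that by (simp add: emeasure_density indicator_inter_arith[symmetric] Int_commute)
    have "emeasure D A = emeasure G (A \<inter> Y) - emeasure S (A \<inter> Y)"
      unfolding D_def using A dG[OF A] dS[OF A]
      by (subst emeasure_diff_measure)
        (auto intro!: finite_measureI le1 simp: dG dS eS G.emeasure_eq_measure sets_eq_imp_space_eq[OF sS])
    then show ?thesis
      using m by (simp add: eS G.emeasure_eq_measure ennreal_minus)
  qed
  define N where "N = measure G Y - (1 - m) * measure P Y"
  have compl: "measure G (- Y) = 1 - measure G Y" "measure P (- Y) = 1 - measure P Y"
    using G.prob_compl[of Y] P.prob_compl[of Y] by (auto simp: Compl_eq_Diff_UNIV)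
  \<comment> \<open>On \<open>- Y\<close> the difference lies between \<open>- \<delta>\<close> and
    \<open>0\<close>, while its total mass is \<open>m\<close>.\<close>
  have N: "m \<le> N" "N - m \<le> \<delta>"
    using le2[of "- Y"] d[of "- Y"] by (auto simp: compl N_def algebra_simps)
  define Q where "Q = scale_measure (ennreal (1 / N)) D"
  have sQ [simp]: "sets Q = sets borel" by (simp add: Q_def D_def)
  have eQ: "emeasure Q A = ennreal ((measure G (A \<inter> Y) - (1 - m) * measure P (A \<inter> Y)) / N)"
    if "A \<in> sets borel" for A
    using that N m le1[of "A \<inter> Y"] by (simp add: Q_def eD ennreal_mult[symmetric])
  have pQ: "prob_space Q"
  proof
    show "emeasure Q (space Q) = 1"
      using eQ[of UNIV] N m by (simp add: sets_eq_imp_space_eq[OF sQ] N_def[symmetric])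
  qed
  have mQ: "measure Q A = (measure G (A \<inter> Y) - (1 - m) * measure P (A \<inter> Y)) / N"
    if "A \<in> sets borel" for A
    using eQ[OF that] N m le1[of "A \<inter> Y"] that by (simp add: measure_def[of Q])
  let ?K = "mixture m P Q"
  have pK: "prob_space ?K" using prob_space_mixture[OF P(1) pQ] m by simp
  have up: "measure ?K A - measure G A \<le> \<delta>" if A [measurable]: "A \<in> sets borel" for A
  proof -
    let ?v = "measure G (A \<inter> Y) - (1 - m) * measure P (A \<inter> Y)"
    have "m * (?v / N) \<le> ?v"
    proof -
      have "m / N * ?v \<le> 1 * ?v"
        using N m le1[of "A \<inter> Y"] by (intro mult_right_mono) auto
      then show ?thesis by simp
    qed
    moreover have "measure G A = measure G (A \<inter> Y) + measure G (A - Y)"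
      using G.finite_measure_Union[of "A \<inter> Y" "A - Y"] by (simp add: Int_Diff_Un Int_Diff_disjoint)
    moreover have "measure P A = measure P (A \<inter> Y) + measure P (A - Y)"
      using P.finite_measure_Union[of "A \<inter> Y" "A - Y"] by (simp add: Int_Diff_Un Int_Diff_disjoint)
    moreover have "(1 - m) * measure P (A - Y) - measure G (A - Y) \<le> \<delta>"
      using d[of "A - Y"] by simp
    ultimately show ?thesis
      using m by (simp add: measure_mixture[OF P(1) pQ] mQ algebra_simps)
  qed
  \<comment> \<open>The lower bound is the upper bound on the complement, since both measures have
    mass 1.\<close>
  have "\<bar>measure ?K A - measure G A\<bar> \<le> \<delta>" if A [measurable]: "A \<in> sets borel" for A
    using up[OF A] up[of "- A"] G.prob_compl[of A] prob_space.prob_compl[OF pK, of A]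
    by (auto simp: Compl_eq_Diff_UNIV)
  then show ?thesis using pQ sQ by blast
qed

text \<open>\<open>Q1\<close> puts the mass \<open>e\<close> on \<open>T\<close>, distributed like
  \<open>P\<close>, while off \<open>T\<close> the component \<open>P'\<close> suffices. This gives
  the one-sided bound from which \<open>ex_contamination_close\<close> produces
  \<open>Q0\<close>.\<close>

lemma ex_contaminations_close:
  fixes P P' :: "real measure"
  assumes P: "prob_space P" "sets P = sets borel" and P': "prob_space P'" "sets P' = sets borel"
    and m: "0 < m" "m \<le> 1" and e: "0 \<le> e" "e \<le> 1" and "0 \<le> \<delta>"
    and T [measurable]: "T \<in> sets borel" and T_pos: "0 < measure P T"
    and T_small: "(1 - m) * measure P T \<le> e + \<delta>"
    and dom: "\<And>A. A \<in> sets borel \<Longrightarrow> A \<inter> T = {} \<Longrightarrow> (1 - m) * measure P A \<le> (1 - e) * measure P' A"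
  shows "\<exists>Q0 Q1. prob_space Q0 \<and> sets Q0 = sets borel \<and> prob_space Q1 \<and> sets Q1 = sets borel \<and>
    (\<forall>A\<in>sets borel. \<bar>measure (mixture m P Q0) A - measure (mixture e P' Q1) A\<bar> \<le> \<delta>)"
proof -
  interpret P: prob_space P by fact
  interpret P': prob_space P' by fact
  note [measurable_cong] = P(2) P'(2)
  note [simp] = P(2) P'(2)
  define Q1 where "Q1 = uniform_measure P T"
  have nz: "emeasure P T \<noteq> 0" "emeasure P T \<noteq> \<infinity>"
    using T_pos by (auto simp: P.emeasure_eq_measure)
  have pQ: "prob_space Q1" unfolding Q1_def by (rule prob_space_uniform_measure[OF nz])
  have sQ [simp]: "sets Q1 = sets borel" by (simp add: Q1_def)
  have mQ: "measure Q1 A = measure P (A \<inter> T) / measure P T" if "A \<in> sets borel" for A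
    using measure_uniform_measure[OF nz, of A] that by (simp add: Q1_def Int_commute)
  let ?G = "mixture e P' Q1"
  have "(1 - m) * measure P A - measure ?G A \<le> \<delta>" if A [measurable]: "A \<in> sets borel" for A
  proof -
    have split: "measure P A = measure P (A \<inter> T) + measure P (A - T)"
      using P.finite_measure_Union[of "A \<inter> T" "A - T"] by (simp add: Int_Diff_Un Int_Diff_disjoint)
    have "(1 - m) * measure P (A - T) \<le> (1 - e) * measure P' (A - T)"
      by (rule dom) auto
    also have "\<dots> \<le> (1 - e) * measure P' A"
      using e by (intro mult_left_mono P'.finite_measure_mono) auto
    finally have body: "(1 - m) * measure P (A - T) \<le> (1 - e) * measure P' A" .
    \<comment> \<open>A piece of \<open>T\<close> incurs the same fraction \<open>?x\<close> of the
      total shortfall \<open>(1 - m) * measure P T - e\<close>, which is at most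
      \<open>\<delta>\<close> but may be negative.\<close>
    have tail: "(1 - m) * measure P (A \<inter> T) - e * (measure P (A \<inter> T) / measure P T) \<le> \<delta>"
    proof -
      let ?x = "measure P (A \<inter> T) / measure P T"
      have x: "0 \<le> ?x" "?x \<le> 1"
        using T_pos by (auto intro!: P.finite_measure_mono simp: divide_le_eq_1)
      have "((1 - m) * measure P T - e) * ?x \<le> \<delta> * ?x"
        using T_small x by (intro mult_right_mono) auto
      also have "\<delta> * ?x \<le> \<delta>" using mult_left_mono[OF x(2) \<open>0 \<le> \<delta>\<close>] by simp
      finally have "((1 - m) * measure P T - e) * ?x \<le> \<delta>" .
      moreover have "((1 - m) * measure P T - e) * ?x = (1 - m) * measure P (A \<inter> T) - e * ?x"
        using T_pos by (simp add: field_simps)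
      ultimately show ?thesis by simp
    qed
    show ?thesis
      using body tail e by (simp add: measure_mixture[OF P'(1) pQ] mQ split algebra_simps)
  qed
  from ex_contamination_close[OF P _ _ m this] prob_space_mixture[OF P'(1) pQ] e
  obtain Q0 where "prob_space Q0" "sets Q0 = sets borel"
    "\<forall>A\<in>sets borel. \<bar>measure (mixture m P Q0) A - measure ?G A\<bar> \<le> \<delta>" by auto
  with pQ sQ show ?thesis by blast
qed

section \<open>Location shifts and domination\<close>

lemma sets_location_shift [simp, measurable_cong]: "sets (location_shift P \<theta>) = sets borel"
  by (simp add: location_shift_def)

lemma measure_location_shift:
  assumes "sets P = sets borel" "A \<in> sets borel"
  shows "measure (location_shift P \<theta>) A = measure P {x. x + \<theta> \<in> A}"
  using assms sets_eq_imp_space_eq[OF assms(1)] unfolding location_shift_def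
  by (subst measure_distr) (auto simp: vimage_def cong: measurable_cong_sets)

lemma prob_space_location_shift:
  assumes "prob_space P" "sets P = sets borel"
  shows "prob_space (location_shift P \<theta>)"
  unfolding location_shift_def using assms
  by (intro prob_space.prob_space_distr) (auto cong: measurable_cong_sets)

lemma measure_uminus_eq_of_even_density:
  fixes f :: "real \<Rightarrow> real"
  assumes [measurable]: "f \<in> borel_measurable borel" and "\<And>x. f (- x) = f x"
    and [measurable]: "A \<in> sets borel"
  shows "measure (density lborel (\<lambda>x. ennreal (f x))) {x. - x \<in> A}
    = measure (density lborel (\<lambda>x. ennreal (f x))) A"
proof -
  have [measurable]: "{x. - x \<in> A} \<in> sets borel"
    using measurable_sets[of uminus borel borel A] by (simp add: vimage_def)
  have "(\<integral>\<^sup>+x. ennreal (f x) * indicator A x \<partial>lborel)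
      = (\<integral>\<^sup>+x. ennreal (f x) * indicator {x. - x \<in> A} x \<partial>lborel)"
    by (subst nn_integral_real_affine[where c = "-1" and t = 0])
      (auto simp: assms(2) indicator_def intro!: nn_integral_cong)
  then show ?thesis by (simp add: measure_def emeasure_density)
qed

text \<open>The shift by \<open>- s\<close> has density \<open>f (u + s)\<close>, so the pointwise
  bound integrates over \<open>A\<close>.\<close>

lemma measure_le_location_shift_of_density_le:
  fixes f :: "real \<Rightarrow> real"
  assumes P_def: "P = density lborel (\<lambda>x. ennreal (f x))" and P: "prob_space P"
    and [measurable]: "f \<in> borel_measurable borel"
    and C: "0 \<le> C" and le: "\<And>u. u \<in> W \<Longrightarrow> f u \<le> C * f (u + s)"
    and A [measurable]: "A \<in> sets borel" and AW: "A \<subseteq> W"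
  shows "measure P A \<le> C * measure (location_shift P (- s)) A"
proof -
  interpret P: prob_space P by fact
  have sP: "sets P = sets borel" by (simp add: P_def)
  have [measurable]: "{x. x + - s \<in> A} \<in> sets borel"
    using measurable_sets[of "\<lambda>x. x + - s" borel borel A] by (simp add: vimage_def)
  have "emeasure P A = (\<integral>\<^sup>+x. ennreal (f x) * indicator A x \<partial>lborel)"
    by (simp add: P_def emeasure_density)
  \<comment> \<open>The argument is written \<open>s + 1 * x\<close> to match the affine change of
    variables that follows.\<close>
  also have "\<dots> \<le> (\<integral>\<^sup>+x. ennreal C * (ennreal (f (s + 1 * x)) * indicator {x. x + - s \<in> A} (s + 1 * x)) \<partial>lborel)"
    using le AW C by (intro nn_integral_mono)
      (auto simp: indicator_def ennreal_mult'[symmetric] add.commute intro!: ennreal_leI)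
  also have "\<dots> = ennreal C * (\<integral>\<^sup>+x. ennreal (f x) * indicator {x. x + - s \<in> A} x \<partial>lborel)"
    by (subst nn_integral_real_affine[where c = 1 and t = s
          and f = "\<lambda>x. ennreal (f x) * indicator {x. x + - s \<in> A} x"])
      (auto simp: nn_integral_cmult)
  also have "\<dots> = ennreal C * emeasure P {x. x + - s \<in> A}"
    by (simp add: P_def emeasure_density)
  finally show ?thesis
    using C by (simp add: P.emeasure_eq_measure ennreal_mult'[symmetric] measure_location_shift[OF sP A])
qed

text \<open>The mass of a compact set under the shift by \<open>s\<close> is upper semicontinuous in
  \<open>s\<close>, the direction needed on the right-hand side. It then remains to approximate
  \<open>N\<close> from inside by compact sets.\<close>

lemma location_shift_dominates_limit:
  fixes P N :: "real measure"
  assumes P: "prob_space P" "sets P = sets borel" and N: "prob_space N" "sets N = sets borel"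
    and c: "0 < c" and d: "0 \<le> d"
    and lim: "\<And>\<eta>. 0 < \<eta> \<Longrightarrow> \<exists>s. \<bar>s - r\<bar> < \<eta> \<and>
      (\<forall>A\<in>sets borel. A \<subseteq> W \<longrightarrow> c * measure N A \<le> d * measure (location_shift P s) A)"
    and A: "A \<in> sets borel" "A \<subseteq> W"
  shows "c * measure N A \<le> d * measure (location_shift P r) A"
proof -
  interpret P: prob_space P by fact
  interpret N: prob_space N by fact
  note [measurable_cong] = P(2)
  note [simp] = P(2) N(2)
  let ?L = "location_shift P r"
  interpret L: prob_space ?L by (rule prob_space_location_shift[OF P])
  have compact_le: "c * measure N K \<le> d * measure ?L K" if K: "compact K" "K \<subseteq> W" for K
  proof (rule field_le_epsilon)
    fix e :: real assume "0 < e"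
    \<comment> \<open>The denominator \<open>d + 1\<close> stays positive when
      \<open>d = 0\<close>.\<close>
    define \<eta> where "\<eta> = e / (d + 1)"
    have \<eta>: "0 < \<eta>" "d * \<eta> \<le> e"
      using \<open>0 < e\<close> d by (auto simp: \<eta>_def field_simps)
    have Kb [measurable]: "K \<in> sets borel" using K(1) by (simp add: borel_compact)
    have "(INF U \<in> {U. K \<subseteq> U \<and> open U}. emeasure ?L U) = emeasure ?L K"
      using outer_regular[of ?L K] Kb L.emeasure_space_1 by simp
    also have "\<dots> < emeasure ?L K + ennreal \<eta>"
      using \<eta> by (simp add: L.emeasure_eq_measure ennreal_plus[symmetric] ennreal_less_iff del: ennreal_plus)
    finally obtain U where U: "K \<subseteq> U" "open U" "emeasure ?L U < emeasure ?L K + ennreal \<eta>"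
      by (auto simp: INF_less_iff)
    have LU: "measure ?L U \<le> measure ?L K + \<eta>"
      using U(3) \<eta> by (simp add: L.emeasure_eq_measure ennreal_plus[symmetric] ennreal_less_iff del: ennreal_plus)
    \<comment> \<open>A uniform margin \<open>b\<close> around \<open>K\<close> inside
      \<open>U\<close> absorbs the discrepancy between the shifts \<open>s\<close> and
      \<open>r\<close>.\<close>
    obtain b where b: "0 < b" "(\<Union>x\<in>K. ball x b) \<subseteq> U"
      using compact_subset_open_imp_ball_epsilon_subset[OF K(1) U(2,1)] by blast
    obtain s where s: "\<bar>s - r\<bar> < b" "c * measure N K \<le> d * measure (location_shift P s) K"
      using lim[OF b(1)] Kb K(2) by blast
    have "{x. x + s \<in> K} \<subseteq> {x. x + r \<in> U}"
    proof
      fix x assume "x \<in> {x. x + s \<in> K}"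
      then have "ball (x + s) b \<subseteq> U" using b(2) by blast
      moreover have "x + r \<in> ball (x + s) b" using s(1) by (simp add: dist_real_def)
      ultimately show "x \<in> {x. x + r \<in> U}" by blast
    qed
    moreover have "{x. x + r \<in> U} \<in> sets borel"
      using measurable_sets[of "\<lambda>x. x + r" borel borel U] U(2) by (simp add: vimage_def)
    ultimately have "measure (location_shift P s) K \<le> measure ?L U"
      using U(2) by (auto simp: measure_location_shift intro!: P.finite_measure_mono)
    with LU have "d * measure (location_shift P s) K \<le> d * (measure ?L K + \<eta>)"
      using d by (intro mult_left_mono) auto
    with s(2) \<eta> show "c * measure N K \<le> d * measure ?L K + e"
      by (simp add: algebra_simps)
  qed
  have "emeasure N A = (SUP K \<in> {K. K \<subseteq> A \<and> compact K}. emeasure N K)"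
    using inner_regular[of N A] A N.emeasure_space_1 by simp
  also have "\<dots> \<le> ennreal (d * measure ?L A / c)"
  proof (rule SUP_least)
    fix K assume K: "K \<in> {K. K \<subseteq> A \<and> compact K}"
    then have "c * measure N K \<le> d * measure ?L K" using A by (intro compact_le) auto
    also have "\<dots> \<le> d * measure ?L A"
      using K A d by (intro mult_left_mono L.finite_measure_mono) auto
    finally show "emeasure N K \<le> ennreal (d * measure ?L A / c)"
      using c by (simp add: N.emeasure_eq_measure ennreal_leI field_simps)
  qed
  finally have "measure N A \<le> d * measure ?L A / c"
    using c d by (simp add: N.emeasure_eq_measure)
  then show ?thesis using c by (simp add: field_simps)
qed

section \<open>Quantiles and shifts tending to infinity\<close>

text \<open>Continuity makes the superlevel set closed, so its infimum is attained with value at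
  least \<open>p\<close>; a point of value exactly \<open>p\<close>, from the intermediate value
  theorem, lies at or above it and gives the reverse inequality.\<close>

lemma (in real_distribution) quantile_of_continuous_cdf:
  assumes cont: "\<And>x. isCont (cdf M) x" and p: "0 < p" "p < 1"
  shows "\<exists>z. quantile M p = ereal z \<and> cdf M z = p"
proof -
  let ?X = "{t. p \<le> cdf M t}"
  obtain a where a: "cdf M a < p"
    using order_tendstoD(2)[OF cdf_lim_at_bot p(1)] by (auto simp: eventually_at_bot_linorder)
  obtain b where b: "p < cdf M b"
    using order_tendstoD(1)[OF cdf_lim_at_top_prob p(2)] by (auto simp: eventually_at_top_linorder)
  have bdd: "bdd_below ?X"
  proof (rule bdd_belowI[of _ a])
    fix t assume "t \<in> ?X"
    with a show "a \<le> t" using cdf_nondecreasing[of t a] by (cases "a \<le> t") auto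
  qed
  have ne: "?X \<noteq> {}" using b by (auto intro: less_imp_le)
  have "closed ?X"
    using cont by (intro closed_Collect_le continuous_on_const continuous_at_imp_continuous_on) auto
  then have "Inf ?X \<in> ?X" using closed_contains_Inf[OF ne bdd] by simp
  moreover have "\<exists>x. a \<le> x \<and> x \<le> b \<and> cdf M x = p"
  proof (rule IVT)
    show "a \<le> b" using a b cdf_nondecreasing[of b a] by (cases "a \<le> b") auto
  qed (use a b cont in auto)
  then obtain x where x: "cdf M x = p" by blast
  then have "cdf M (Inf ?X) \<le> p"
    using cInf_lower[of x ?X] bdd cdf_nondecreasing[of "Inf ?X" x] by simp
  moreover have "quantile M p = ereal (Inf ?X)"
    unfolding quantile_def using ereal_Inf'[OF bdd ne] by simp
  ultimately show ?thesis by (intro exI[of _ "Inf ?X"]) auto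
qed

text \<open>Rules out an infinite radius: a fixed interval of positive mass would be dominated by
  the masses of upper tails, which tend to 0.\<close>

lemma (in real_distribution) location_shift_not_dominates_at_infinity:
  assumes c: "0 < c" and z: "0 < cdf M z"
    and unb: "\<And>x. \<exists>s>x. \<forall>A\<in>sets borel. A \<subseteq> {..z} \<longrightarrow>
      c * measure M A \<le> d * measure (location_shift M (- s)) A"
    and d: "0 \<le> d"
  shows False
proof -
  obtain a where a: "cdf M a < cdf M z"
    using order_tendstoD(2)[OF cdf_lim_at_bot z] by (auto simp: eventually_at_bot_linorder)
  then have az: "a < z" using cdf_nondecreasing[of z a] by (cases "a < z") auto
  have mA: "measure M {a<..z} = cdf M z - cdf M a" using cdf_diff_eq[OF az] by simp
  have "((\<lambda>y. d * (1 - cdf M y)) \<longlongrightarrow> d * (1 - 1)) at_top"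
    by (intro tendsto_intros cdf_lim_at_top_prob)
  then have "eventually (\<lambda>y. d * (1 - cdf M y) < c * (cdf M z - cdf M a)) at_top"
    using a c by (intro order_tendstoD(2)) auto
  then obtain X where X: "\<And>y. X \<le> y \<Longrightarrow> d * (1 - cdf M y) < c * (cdf M z - cdf M a)"
    by (auto simp: eventually_at_top_linorder)
  obtain s where s: "X - a < s" "c * measure M {a<..z} \<le> d * measure (location_shift M (- s)) {a<..z}"
  proof -
    obtain s where s: "X - a < s" and dom: "\<forall>A\<in>sets borel. A \<subseteq> {..z} \<longrightarrow>
        c * measure M A \<le> d * measure (location_shift M (- s)) A"
      using unb by blast
    moreover have "{a<..z} \<in> sets borel" "{a<..z} \<subseteq> {..z}" by auto
    ultimately show thesis by (intro that[OF s]) blast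
  qed
  \<comment> \<open>Undoing the shift turns the interval into \<open>{a + s<..z + s}\<close>, which
    lies in the tail beyond \<open>a + s\<close>.\<close>
  have "measure (location_shift M (- s)) {a<..z} \<le> measure M (space M - {..a + s})"
    by (auto simp: measure_location_shift intro!: finite_measure_mono)
  also have "\<dots> = 1 - cdf M (a + s)"
    by (subst prob_compl) (auto simp: cdf_def)
  finally have "d * measure (location_shift M (- s)) {a<..z} \<le> d * (1 - cdf M (a + s))"
    using d by (intro mult_left_mono)
  with s X[of "a + s"] show False by (simp add: mA)
qed

section \<open>Total variation between the contaminated samples\<close>

text \<open>Supplies the lower bound that makes the real-valued infimum in the theorem a genuine
  one; the empty event contributes 0 to the supremum.\<close>

lemma TV_nonneg:
  assumes "prob_space P" "prob_space Q"
  shows "0 \<le> TV P Q"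
proof -
  interpret P: prob_space P by fact
  interpret Q: prob_space Q by fact
  have "bdd_above ((\<lambda>B. \<bar>measure P B - measure Q B\<bar>) ` sets P)"
  proof (rule bdd_aboveI2[where M = 1])
    fix B
    show "\<bar>measure P B - measure Q B\<bar> \<le> 1"
      using P.prob_le_1[of B] Q.prob_le_1[of B] measure_nonneg[of P B] measure_nonneg[of Q B] by linarith
  qed
  from cSUP_upper[OF sets.empty_sets this] show ?thesis
    unfolding TV_def by simp
qed

text \<open>Reduces the theorem to finding a set \<open>T\<close> of small mass off which domination
  holds: one-sample distances \<open>\<alpha> / n\<close> add up to \<open>\<alpha>\<close> over
  \<open>n\<close> coordinates.\<close>

lemma INF_TV_contaminated_le:
  fixes P0 :: "real measure"
  assumes P0: "prob_space P0" "sets P0 = sets borel"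
    and m: "0 < m" "m \<le> 1" and e: "0 \<le> e" "e \<le> 1" and \<alpha>: "0 \<le> \<alpha>" and n: "0 < n"
    and T: "T \<in> sets borel" "0 < measure (location_shift P0 \<theta>) T"
      "(1 - m) * measure (location_shift P0 \<theta>) T \<le> e + \<alpha> / real n"
    and dom: "\<And>A. A \<in> sets borel \<Longrightarrow> A \<inter> T = {} \<Longrightarrow>
      (1 - m) * measure (location_shift P0 \<theta>) A \<le> (1 - e) * measure (location_shift P0 \<theta>') A"
  shows "(INF (Q0, Q1)\<in>space (prob_algebra borel) \<times> space (prob_algebra borel).
       TV (iid_product n (contaminated P0 m \<theta> Q0)) (iid_product n (contaminated P0 e \<theta>' Q1))) \<le> \<alpha>"
proof -
  let ?P = "location_shift P0 \<theta>" and ?P' = "location_shift P0 \<theta>'"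
  have pP: "prob_space ?P" "prob_space ?P'"
    using prob_space_location_shift[OF P0] by auto
  have pc: "prob_space (contaminated P0 m \<theta> Q)" "prob_space (contaminated P0 e \<theta>' Q)"
    if "prob_space Q" "sets Q = sets borel" for Q
    using prob_space_mixture[OF pP(1) that(1)] prob_space_mixture[OF pP(2) that(1)] that(2) m e
    by (simp_all add: contaminated_def)
  obtain Q0 Q1 where Q: "prob_space Q0" "sets Q0 = sets borel" "prob_space Q1" "sets Q1 = sets borel"
    and close: "\<forall>A\<in>sets borel. \<bar>measure (mixture m ?P Q0) A - measure (mixture e ?P' Q1) A\<bar> \<le> \<alpha> / real n"
  proof -
    have "0 \<le> \<alpha> / real n" using \<alpha> by simp
    from ex_contaminations_close[OF pP(1) sets_location_shift pP(2) sets_location_shift m e this T dom]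
    show thesis using that by blast
  qed
  have "\<bar>measure (iid_product n (contaminated P0 m \<theta> Q0)) B
      - measure (iid_product n (contaminated P0 e \<theta>' Q1)) B\<bar> \<le> real n * (\<alpha> / real n)"
    if "B \<in> sets (iid_product n (contaminated P0 m \<theta> Q0))" for B
    by (rule abs_measure_iid_product_diff_le[OF pc(1)[OF Q(1,2)] pc(2)[OF Q(3,4)] _ _ that])
      (use close in \<open>simp_all add: contaminated_def\<close>)
  then have TV: "TV (iid_product n (contaminated P0 m \<theta> Q0)) (iid_product n (contaminated P0 e \<theta>' Q1)) \<le> \<alpha>"
    unfolding TV_def using n by (intro cSUP_least) auto
  have "prob_space (iid_product n P)" if "prob_space P" for P
    unfolding iid_product_def using that by (intro prob_space_PiM)
  then have bdd: "bdd_below ((\<lambda>(Q0, Q1). TV (iid_product n (contaminated P0 m \<theta> Q0))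
      (iid_product n (contaminated P0 e \<theta>' Q1))) ` (space (prob_algebra borel) \<times> space (prob_algebra borel)))"
    using pc by (intro bdd_belowI2[where m = 0]) (auto simp: space_prob_algebra intro!: TV_nonneg)
  show ?thesis
    by (rule cINF_lower2[OF bdd, of "(Q0, Q1)"]) (use Q TV in \<open>auto simp: space_prob_algebra\<close>)
qed

section \<open>The radius and the final estimate\<close>

text \<open>The supremum defining the radius may be infinite or fail to be attained, so admissible
  shifts \<open>s\<close> above a given \<open>y\<close> take its place.\<close>

lemma r_low_approx:
  assumes q: "quantile P (1 - q_low m \<alpha> n e) = ereal z"
    and y: "ereal y < r_low P f m \<alpha> n e"
  shows "\<exists>s>y. ereal s \<le> r_low P f m \<alpha> n e \<and>
    (\<forall>u\<le>z. f u \<le> (1 - max e (\<alpha> / real n)) / (1 - m) * f (u + s))"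
proof -
  let ?C = "(1 - max e (\<alpha> / real n)) / (1 - m)"
  let ?S = "{s::real. s \<ge> 0 \<and> (SUP t\<in>{t. ereal t \<le> ereal s + ereal z}. ereal (f (t - s) - ?C * f t)) \<le> 0}"
  have r: "r_low P f m \<alpha> n e = (SUP s\<in>?S. ereal s)"
    unfolding r_low_def q ..
  obtain s where s: "s \<in> ?S" "y < s"
    using y unfolding r less_SUP_iff by auto
  have "f u \<le> ?C * f (u + s)" if "u \<le> z" for u
  proof -
    \<comment> \<open>The defining inequality is read at \<open>t = u + s\<close>, where
      \<open>t \<le> s + z\<close> becomes \<open>u \<le> z\<close>.\<close>
    have "ereal (f (u + s - s) - ?C * f (u + s))
        \<le> (SUP t\<in>{t. ereal t \<le> ereal s + ereal z}. ereal (f (t - s) - ?C * f t))"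
      using that by (intro SUP_upper) auto
    also have "\<dots> \<le> 0" using s(1) by simp
    finally show ?thesis by simp
  qed
  moreover have "ereal s \<le> r_low P f m \<alpha> n e" unfolding r by (rule SUP_upper[OF s(1)])
  ultimately show ?thesis using s(2) by blast
qed

text \<open>An infinite radius leaves \<open>r\<close> arbitrary; the proof shows that it can occur
  only at quantile level 0.\<close>

theorem theorem4:
  fixes P0 :: "real measure" and f :: "real \<Rightarrow> real"
    and \<epsilon>max \<alpha> :: real and n :: nat
  assumes "prob_space P0"
    and "f \<in> borel_measurable borel"
    and "\<And>x. 0 \<le> f x"
    and "P0 = density lborel (\<lambda>x. ennreal (f x))"
    and "continuous_on {x. f x \<noteq> 0} f"
    and "\<And>x. f (- x) = f x"
    and "0 < \<epsilon>max" "\<epsilon>max < 1"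
    and "0 < \<alpha>" "\<alpha> < 1"
    and "real n \<ge> 1 / \<epsilon>max"
    and "q_low \<epsilon>max \<alpha> n \<epsilon>max \<le> 1"
  shows "\<forall>\<sigma>\<in>{1, - 1}. \<forall>\<theta>::real. \<forall>\<epsilon>\<in>{0..\<epsilon>max}. \<forall>r::real.
    r_low P0 f \<epsilon>max \<alpha> n \<epsilon> = ereal r \<or> r_low P0 f \<epsilon>max \<alpha> n \<epsilon> = \<infinity> \<longrightarrow>
    (INF (Q0, Q1)\<in>space (prob_algebra borel) \<times> space (prob_algebra borel).
       TV (iid_product n (contaminated P0 \<epsilon>max \<theta> Q0))
          (iid_product n (contaminated P0 \<epsilon> (\<theta> + \<sigma> * r) Q1))) \<le> \<alpha>"
proof (intro ballI allI impI)
  fix \<sigma> \<theta> \<epsilon> r :: real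
  assume \<sigma>: "\<sigma> \<in> {1, - 1}" and \<epsilon>: "\<epsilon> \<in> {0..\<epsilon>max}"
    and r: "r_low P0 f \<epsilon>max \<alpha> n \<epsilon> = ereal r \<or> r_low P0 f \<epsilon>max \<alpha> n \<epsilon> = \<infinity>"
  have sP0 [simp, measurable_cong]: "sets P0 = sets borel" by (simp add: assms(4))
  interpret P0: real_distribution P0
    using assms(1) by (simp add: real_distribution_def real_distribution_axioms_def)
  define \<delta> where "\<delta> = \<alpha> / real n"
  define q where "q = q_low \<epsilon>max \<alpha> n \<epsilon>"
  have "0 < 1 / \<epsilon>max" using assms(7) by simp
  then have n: "0 < n" using assms(11) by (cases n) auto
  have \<delta>: "0 < \<delta>" "\<delta> < 1"
    using n assms(9,10) by (auto simp: \<delta>_def field_simps)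
  have q_eq: "2 * (1 - \<epsilon>max) * q = \<epsilon> + \<delta> * (1 - \<epsilon>max)"
    using assms(8) by (simp add: q_def q_low_def \<delta>_def)
  have "0 < 2 * (1 - \<epsilon>max) * q"
    unfolding q_eq using \<epsilon> \<delta> assms(8) by (intro add_nonneg_pos) auto
  then have q_pos: "0 < q" using assms(8) by (simp add: zero_less_mult_iff)
  have "q \<le> q_low \<epsilon>max \<alpha> n \<epsilon>max"
    unfolding q_def q_low_def using \<epsilon> assms(8) by (intro mult_left_mono) auto
  then have q_le: "q \<le> 1" using assms(12) by simp
  \<comment> \<open>By \<open>q_eq\<close>, \<open>(1 - \<epsilon>max) * q\<close> is half of
    \<open>\<epsilon> + \<delta> * (1 - \<epsilon>max)\<close>; the result bounds the mass of the
    tail.\<close>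
  have "\<delta> * (1 - \<epsilon>max) \<le> \<delta> * 1" using \<delta> assms(7) by (intro mult_left_mono) auto
  then have q_small: "(1 - \<epsilon>max) * q \<le> \<epsilon> + \<alpha> / real n"
    using q_eq \<epsilon> \<delta>(1) unfolding \<delta>_def[symmetric] mult.assoc atLeastAtMost_iff by linarith
  note finish = INF_TV_contaminated_le[OF assms(1) sP0 assms(7) _ _ _ _ n, of \<epsilon> \<alpha>]
  show "(INF (Q0, Q1)\<in>space (prob_algebra borel) \<times> space (prob_algebra borel).
       TV (iid_product n (contaminated P0 \<epsilon>max \<theta> Q0))
          (iid_product n (contaminated P0 \<epsilon> (\<theta> + \<sigma> * r) Q1))) \<le> \<alpha>"
  proof (cases "q = 1")
    \<comment> \<open>The tail is now the whole line, so domination concerns only the empty set and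
      any \<open>r\<close> works.\<close>
    case True
    have "measure (location_shift P0 \<theta>) UNIV = 1"
      using P0.prob_space by (simp add: measure_location_shift)
    then show ?thesis
      using \<epsilon> assms(8,9) q_small True by (intro finish[where T = UNIV]) auto
  next
    case False
    define C where "C = (1 - max \<epsilon> \<delta>) / (1 - \<epsilon>max)"
    have C: "0 \<le> C" "(1 - \<epsilon>max) * C \<le> 1 - \<epsilon>"
      using \<epsilon> \<delta> assms(8) by (auto simp: C_def)
    \<comment> \<open>A law with a density has no atoms.\<close>
    have "isCont (cdf P0) x" for x
    proof -
      have "AE y in lborel. y \<noteq> x" by (rule AE_lborel_singleton)
      then have "(\<integral>\<^sup>+y. ennreal (f y) * indicator {x} y \<partial>lborel) = 0"
        using assms(2) by (subst nn_integral_0_iff_AE) (auto simp: indicator_def elim: eventually_mono)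
      then have "emeasure P0 {x} = 0"
        using assms(2) unfolding assms(4) by (subst emeasure_density) auto
      then show ?thesis by (simp add: P0.isCont_cdf measure_def)
    qed
    then obtain z where z: "quantile P0 (1 - q) = ereal z" "cdf P0 z = 1 - q"
      using P0.quantile_of_continuous_cdf[of "1 - q"] q_pos q_le False by auto
    have near: "\<exists>s>y. ereal s \<le> r_low P0 f \<epsilon>max \<alpha> n \<epsilon> \<and>
        (\<forall>A\<in>sets borel. A \<subseteq> {..z} \<longrightarrow>
          (1 - \<epsilon>max) * measure P0 A \<le> (1 - \<epsilon>) * measure (location_shift P0 (- s)) A)"
      if y: "ereal y < r_low P0 f \<epsilon>max \<alpha> n \<epsilon>" for y
    proof -
      obtain s where s: "y < s" "ereal s \<le> r_low P0 f \<epsilon>max \<alpha> n \<epsilon>"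
        and le: "\<And>u. u \<le> z \<Longrightarrow> f u \<le> C * f (u + s)"
        using r_low_approx[OF z(1)[unfolded q_def] y] unfolding C_def \<delta>_def by auto
      have "(1 - \<epsilon>max) * measure P0 A \<le> (1 - \<epsilon>) * measure (location_shift P0 (- s)) A"
        if A: "A \<in> sets borel" "A \<subseteq> {..z}" for A
      proof -
        have "measure P0 A \<le> C * measure (location_shift P0 (- s)) A"
          using le by (intro measure_le_location_shift_of_density_le[OF assms(4,1,2) C(1) _ A]) auto
        then have "(1 - \<epsilon>max) * measure P0 A \<le> (1 - \<epsilon>max) * (C * measure (location_shift P0 (- s)) A)"
          using assms(8) by (intro mult_left_mono) auto
        also have "\<dots> \<le> (1 - \<epsilon>) * measure (location_shift P0 (- s)) A"
          using mult_right_mono[OF C(2)] by (simp add: mult.assoc)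
        finally show ?thesis .
      qed
      with s show ?thesis by blast
    qed
    have "r_low P0 f \<epsilon>max \<alpha> n \<epsilon> \<noteq> \<infinity>"
    proof
      assume inf: "r_low P0 f \<epsilon>max \<alpha> n \<epsilon> = \<infinity>"
      show False
      proof (rule P0.location_shift_not_dominates_at_infinity)
        show "\<exists>s>x. \<forall>A\<in>sets borel. A \<subseteq> {..z} \<longrightarrow>
            (1 - \<epsilon>max) * measure P0 A \<le> (1 - \<epsilon>) * measure (location_shift P0 (- s)) A" for x
          using near[of x] inf by auto
      qed (use z q_le False \<epsilon> assms(8) in auto)
    qed
    with r have r: "r_low P0 f \<epsilon>max \<alpha> n \<epsilon> = ereal r" by simp
    \<comment> \<open>As \<open>s\<close> approaches \<open>r\<close> from below, \<open>- s\<close>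
      tends to \<open>- r\<close>, so domination reaches \<open>r\<close> even if the supremum is
      not attained.\<close>
    have dom: "(1 - \<epsilon>max) * measure P0 A \<le> (1 - \<epsilon>) * measure (location_shift P0 (- r)) A"
      if A: "A \<in> sets borel" "A \<subseteq> {..z}" for A
    proof (rule location_shift_dominates_limit[OF assms(1) sP0 assms(1) sP0 _ _ _ A])
      show "\<exists>s. \<bar>s - - r\<bar> < \<eta> \<and> (\<forall>A\<in>sets borel. A \<subseteq> {..z} \<longrightarrow>
          (1 - \<epsilon>max) * measure P0 A \<le> (1 - \<epsilon>) * measure (location_shift P0 s) A)" if "0 < \<eta>" for \<eta>
      proof -
        obtain s where "r - \<eta> < s" "s \<le> r" "\<forall>A\<in>sets borel. A \<subseteq> {..z} \<longrightarrow>
            (1 - \<epsilon>max) * measure P0 A \<le> (1 - \<epsilon>) * measure (location_shift P0 (- s)) A"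
          using near[of "r - \<eta>"] r \<open>0 < \<eta>\<close> by auto
        then show ?thesis by (intro exI[of _ "- s"]) auto
      qed
    qed (use \<epsilon> assms(8) in auto)
    \<comment> \<open>For \<open>\<sigma> = 1\<close> this is the symmetry of \<open>f\<close>; for
      \<open>\<sigma> = - 1\<close> it is trivial.\<close>
    have reflect: "measure P0 {x. - \<sigma> * x \<in> A} = measure P0 A" if "A \<in> sets borel" for A
      using \<sigma> measure_uminus_eq_of_even_density[OF assms(2,6) that] unfolding assms(4)[symmetric] by auto
    have meas: "{x. \<theta> - \<sigma> * x \<in> A} \<in> sets borel" if "A \<in> sets borel" for A
      using measurable_sets[of "\<lambda>x. \<theta> - \<sigma> * x" borel borel A] that by (simp add: vimage_def)
    \<comment> \<open>The map sending \<open>x\<close> to \<open>\<theta> - \<sigma> * x\<close>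
      carries the shift by \<open>- t\<close> to the shift by
      \<open>\<theta> + \<sigma> * t\<close>, so both signs reduce to domination on
      \<open>{..z}\<close>.\<close>
    have shift: "measure (location_shift P0 (\<theta> + \<sigma> * t)) A
        = measure (location_shift P0 (- t)) {x. \<theta> - \<sigma> * x \<in> A}" if A: "A \<in> sets borel" for A t
    proof -
      have "{x. x + (\<theta> + \<sigma> * t) \<in> A} \<in> sets borel"
        using measurable_sets[of "\<lambda>x. x + (\<theta> + \<sigma> * t)" borel borel A] A by (simp add: vimage_def)
      from reflect[OF this] show ?thesis
        using A meas[OF A] by (simp add: measure_location_shift algebra_simps)
    qed
    have shift0: "measure (location_shift P0 \<theta>) A = measure P0 {x. \<theta> - \<sigma> * x \<in> A}"
      if A: "A \<in> sets borel" for A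
      using shift[OF A, of 0] meas[OF A] by (simp add: measure_location_shift)
    \<comment> \<open>The image of \<open>{z<..}\<close> under that map: a lower tail for
      \<open>\<sigma> = 1\<close>, an upper tail for \<open>\<sigma> = - 1\<close>.\<close>
    define T where "T = {x. z < \<sigma> * (\<theta> - x)}"
    have \<sigma>\<sigma>: "\<sigma> * \<sigma> = 1" using \<sigma> by auto
    have T_iff: "\<theta> - \<sigma> * x \<in> T \<longleftrightarrow> z < x" for x
      using \<sigma>\<sigma> by (simp add: T_def mult.assoc[symmetric])
    have T: "T \<in> sets borel" unfolding T_def by measurable
    have "measure (location_shift P0 \<theta>) T = measure P0 (space P0 - {..z})"
      unfolding shift0[OF T] T_iff by (intro arg_cong[where f = "measure P0"]) auto
    also have "\<dots> = q" using z(2) by (subst P0.prob_compl) (auto simp: cdf_def)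
    finally have mT: "measure (location_shift P0 \<theta>) T = q" .
    show ?thesis
    proof (rule finish[where T = T])
      fix A :: "real set" assume A: "A \<in> sets borel" "A \<inter> T = {}"
      have "{x. \<theta> - \<sigma> * x \<in> A} \<subseteq> {..z}"
      proof
        fix x assume "x \<in> {x. \<theta> - \<sigma> * x \<in> A}"
        then have "\<theta> - \<sigma> * x \<notin> T" using A(2) by blast
        then show "x \<in> {..z}" by (simp add: T_iff)
      qed
      then show "(1 - \<epsilon>max) * measure (location_shift P0 \<theta>) A
          \<le> (1 - \<epsilon>) * measure (location_shift P0 (\<theta> + \<sigma> * r)) A"
        unfolding shift[OF A(1)] shift0[OF A(1)] by (intro dom meas A(1))
    qed (use \<epsilon> assms(8,9) T mT q_pos q_small in auto)
  qed
qed

end
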